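(* For every integer $m\ge1$, the $\mathrm{I}_{mm22}$ inequality \[ -p_{\mathrm{A}_1}-\sum_{j=1}^{m}(m-j)\,p_{\mathrm{B}_j}-\sum_{\substack{2\le i,j\le m\\ i+j=m+2}}p_{\mathrm{A}_i\mathrm{B}_j}+\sum_{\substack{1\le i,j\le m\\ i+j\le m+1}}p_{\mathrm{A}_i\mathrm{B}_j}\le 0 \] defines a facet of the correlation polytope $\mathrm{COR}^\square(\mathrm{K}_{m,m})$ (i.e., it is a tight Bell inequality).
   Context: $\mathrm{K}_{m,m}$ is the complete bipartite graph with node set $V=\{\mathrm{A}_1,\dots,\mathrm{A}_m,\mathrm{B}_1,\dots,\mathrm{B}_m\}$ and edge set $E=\{\mathrm{A}_i\mathrm{B}_j:1\le i,j\le m\}$. For a graph $(V,E)$, the correlation polytope $\mathrm{COR}^\square(V,E)\subseteq\mathbb{R}^{V\cup E}$ is the convex hull of the $2^{\lvert V\rvert}$ vectors $\boldsymbol{p}(S)$, $S\subseteq V$, where $p_u(S)=1$ iff $u\in S$ and $p_{uv}(S)=1$ iff $\{u,v\}\subseteq S$ (entries are $0$ otherwise). An inequality is a facet of a polytope $P$ if it is valid for $P$ and the set of points of $P$ satisfying it with equality has dimension $\dim P-1$. *)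

theory Defs
  imports "HOL-Analysis.Analysis"
begin

(* A finite graph has node set UNIV :: 'v set and its edges are indexed by the finite type 'e;
   ends e is the pair {u, v} of end nodes of the edge e.  Thus R^(V Un E) is real ^ ('v + 'e). *)

definition cor_point :: "('e \<Rightarrow> 'v set) \<Rightarrow> 'v set \<Rightarrow> real ^ ('v::finite + 'e::finite)" where
  "cor_point ends S =
     (\<chi> c. case c of Inl u \<Rightarrow> of_bool (u \<in> S) | Inr e \<Rightarrow> of_bool (ends e \<subseteq> S))"

definition cor_polytope :: "('e \<Rightarrow> 'v set) \<Rightarrow> (real ^ ('v::finite + 'e::finite)) set" where
  "cor_polytope ends = convex hull {cor_point ends S | S. S \<subseteq> UNIV}"

(* The inequality f x \<le> b, with f a linear form, is a facet of P. *)
definition defines_facet :: "('a::euclidean_space \<Rightarrow> real) \<Rightarrow> real \<Rightarrow> 'a set \<Rightarrow> bool" where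
  "defines_facet f b P \<longleftrightarrow>
     (\<forall>x\<in>P. f x \<le> b) \<and> aff_dim {x \<in> P. f x = b} = aff_dim P - 1"

(* The complete bipartite graph on two disjoint copies of 'n: K_{m,m} for m = CARD('n). *)

abbreviation nodeA :: "'n \<Rightarrow> 'n + 'n" where "nodeA \<equiv> Inl"
abbreviation nodeB :: "'n \<Rightarrow> 'n + 'n" where "nodeB \<equiv> Inr"

definition bipartite_ends :: "'n \<times> 'n \<Rightarrow> ('n + 'n) set" where
  "bipartite_ends = (\<lambda>(i, j). {nodeA i, nodeB j})"

lemma inj_bipartite_ends: "inj bipartite_ends"
  by (auto simp: inj_def bipartite_ends_def doubleton_eq_iff)

type_synonym 'n bell_space = "real ^ (('n + 'n) + 'n \<times> 'n)"

definition pA :: "('n::finite) bell_space \<Rightarrow> 'n \<Rightarrow> real" where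
  "pA p i = p $ Inl (nodeA i)"

definition pB :: "('n::finite) bell_space \<Rightarrow> 'n \<Rightarrow> real" where
  "pB p j = p $ Inl (nodeB j)"

definition pAB :: "('n::finite) bell_space \<Rightarrow> 'n \<Rightarrow> 'n \<Rightarrow> real" where
  "pAB p i j = p $ Inr (i, j)"

(* l numbers the elements of 'n as l 1, ..., l m, so that A_i is nodeA (l i) and
   B_j is nodeB (l j). *)
definition Imm22 :: "nat \<Rightarrow> (nat \<Rightarrow> 'n::finite) \<Rightarrow> 'n bell_space \<Rightarrow> real" where
  "Imm22 m l p =
     - pA p (l 1)
     - (\<Sum>j = 1..m. (real m - real j) * pB p (l j))
     - (\<Sum>(i, j) \<in> {(i, j). 2 \<le> i \<and> i \<le> m \<and> 2 \<le> j \<and> j \<le> m \<and> i + j = m + 2}. pAB p (l i) (l j))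
     + (\<Sum>(i, j) \<in> {(i, j). 1 \<le> i \<and> i \<le> m \<and> 1 \<le> j \<and> j \<le> m \<and> i + j \<le> m + 1}. pAB p (l i) (l j))"

end

theory Submission
  imports Defs
begin

text \<open>For fixed \<open>a\<^sub>i \<in> {0, 1}\<close> the left-hand side is \<open>- a\<^sub>1 + (\<Sum>k. c\<^sub>k b\<^sub>k)\<close>, where \<open>c\<^sub>k\<close> is
  positive for at most one \<open>k\<close>, namely if \<open>a\<^sub>1 = \<dots> = a\<^sub>k = 1\<close> and \<open>a\<^bsub>k+1\<^esub> = 0\<close> (or \<open>k = m\<close>), and
  then \<open>c\<^sub>k = 1\<close>. The points with equality in which at most two \<open>b\<^sub>k\<close> are nonzero already span a
  hyperplane: a vector orthogonal to all of them and to the point \<open>{A 1}\<close> has only zero entries.\<close>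

section \<open>A spanning criterion for facets through the origin\<close>

text \<open>The face lies in the hyperplane \<open>f = 0\<close> and \<open>y\<close> does not, so
  adjoining \<open>y\<close> raises the dimension by exactly one, to that of the whole space. As 0
  lies in both the face and \<open>P\<close>, affine and linear dimensions agree.\<close>

lemma defines_facetI_span:
  fixes f :: "'a::euclidean_space \<Rightarrow> real"
  assumes f: "linear f" and valid: "\<And>x. x \<in> P \<Longrightarrow> f x \<le> 0"
    and P: "0 \<in> P" "y \<in> P" and y: "f y \<noteq> 0"
    and span: "span (insert y {x \<in> P. f x = 0}) = UNIV"
  shows "defines_facet f 0 P"
proof -
  let ?F = "{x \<in> P. f x = 0}"
  have "f z = 0" if "z \<in> span ?F" for z
    by (rule linear_eq_0_on_span[OF f _ that]) auto
  with y have "y \<notin> span ?F" by blast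
  then have "dim (insert y ?F) = dim ?F + 1" by (simp add: dim_insert)
  moreover have "dim (insert y ?F) = DIM('a)"
    using span by (metis dim_UNIV dim_span)
  moreover have "dim P \<ge> dim (insert y ?F)"
    using P by (intro dim_subset) auto
  ultimately have "dim P = dim ?F + 1"
    using dim_subset_UNIV[of P] by linarith
  moreover have "0 \<in> ?F" using P(1) linear_0[OF f] by simp
  ultimately show ?thesis
    using valid P(1) by (simp add: defines_facet_def aff_dim_zero hull_inc)
qed

lemma span_eq_UNIV_if_orthogonal_0:
  fixes S :: "'a::euclidean_space set"
  assumes "\<And>x. (\<And>y. y \<in> S \<Longrightarrow> x \<bullet> y = 0) \<Longrightarrow> x = 0"
  shows "span S = UNIV"
proof (rule ccontr)
  assume "span S \<noteq> UNIV"
  then obtain a where "a \<noteq> 0" "\<And>x. x \<in> span S \<Longrightarrow> a \<bullet> x = 0"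
    using span_not_univ_subset_hyperplane[of S] by auto
  then show False using assms[of a] by (auto simp: span_base)
qed

lemma linear_Imm22: "linear (Imm22 m l)"
  by (rule linearI)
    (simp_all add: Imm22_def pA_def pB_def pAB_def algebra_simps sum.distrib
      sum_subtractf sum_distrib_left case_prod_unfold)

text \<open>The B-nodes are numbered in reverse, \<open>k = m + 1 - j\<close>: then \<open>B k\<close> meets \<open>A 1, \<dots>, A k\<close> with
  coefficient 1 and \<open>A (k + 1)\<close> with coefficient -1.\<close>

locale numbering =
  fixes m :: nat and l :: "nat \<Rightarrow> 'n::finite"
  assumes m: "m \<ge> 1" and l: "bij_betw l {1..m} (UNIV :: 'n set)"
begin

section \<open>Vertices and inner products in numbered coordinates\<close>

definition r :: "nat \<Rightarrow> 'n" where "r k = l (m + 1 - k)"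

lemma r: "bij_betw r {1..m} UNIV"
proof -
  have "bij_betw (\<lambda>k. m + 1 - k) {1..m} {1..m}"
    by (rule bij_betw_byWitness[where f' = "\<lambda>k. m + 1 - k"]) auto
  from bij_betw_trans[OF this l] show ?thesis by (simp add: r_def[abs_def] o_def)
qed

lemma l_eq_iff: "i \<in> {1..m} \<Longrightarrow> i' \<in> {1..m} \<Longrightarrow> l i = l i' \<longleftrightarrow> i = i'"
  by (rule inj_on_eq_iff[OF bij_betw_imp_inj_on[OF l]])

lemma r_eq_iff: "i \<in> {1..m} \<Longrightarrow> i' \<in> {1..m} \<Longrightarrow> r i = r i' \<longleftrightarrow> i = i'"
  by (rule inj_on_eq_iff[OF bij_betw_imp_inj_on[OF r]])

definition pt :: "nat set \<Rightarrow> nat set \<Rightarrow> 'n bell_space" where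
  "pt X Y = cor_point bipartite_ends (nodeA ` l ` X \<union> nodeB ` r ` Y)"

lemma ex_pt:
  obtains X Y where "X \<subseteq> {1..m}" "Y \<subseteq> {1..m}" "cor_point bipartite_ends S = pt X Y"
proof
  let ?X = "{i \<in> {1..m}. nodeA (l i) \<in> S}" and ?Y = "{k \<in> {1..m}. nodeB (r k) \<in> S}"
  show "?X \<subseteq> {1..m}" "?Y \<subseteq> {1..m}" by auto
  have "x \<in> nodeA ` l ` ?X \<union> nodeB ` r ` ?Y" if "x \<in> S" for x
  proof (cases x)
    case (Inl a)
    moreover obtain i where "i \<in> {1..m}" "a = l i" using l unfolding bij_betw_def by blast
    ultimately show ?thesis using that by blast
  next
    case (Inr a)
    moreover obtain i where "i \<in> {1..m}" "a = r i" using r unfolding bij_betw_def by blast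
    ultimately show ?thesis using that by blast
  qed
  then have "S = nodeA ` l ` ?X \<union> nodeB ` r ` ?Y" by blast
  then show "cor_point bipartite_ends S = pt ?X ?Y" by (simp add: pt_def)
qed

lemma pt_in_cor_polytope: "pt X Y \<in> cor_polytope bipartite_ends"
  unfolding pt_def cor_polytope_def by (rule hull_inc) blast

lemma
  assumes "X \<subseteq> {1..m}" "Y \<subseteq> {1..m}"
  shows pA_pt: "i \<in> {1..m} \<Longrightarrow> pA (pt X Y) (l i) = of_bool (i \<in> X)"
    and pB_pt: "k \<in> {1..m} \<Longrightarrow> pB (pt X Y) (r k) = of_bool (k \<in> Y)"
    and pAB_pt: "i \<in> {1..m} \<Longrightarrow> k \<in> {1..m} \<Longrightarrow>
      pAB (pt X Y) (l i) (r k) = of_bool (i \<in> X) * of_bool (k \<in> Y)"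
proof -
  have X: "l i \<in> l ` X \<longleftrightarrow> i \<in> X" if "i \<in> {1..m}" for i
    using assms that l_eq_iff by blast
  have Y: "r i \<in> r ` Y \<longleftrightarrow> i \<in> Y" if "i \<in> {1..m}" for i
    using assms that r_eq_iff by blast
  show "i \<in> {1..m} \<Longrightarrow> pA (pt X Y) (l i) = of_bool (i \<in> X)"
    using X by (auto simp: pA_def pt_def cor_point_def)
  show "k \<in> {1..m} \<Longrightarrow> pB (pt X Y) (r k) = of_bool (k \<in> Y)"
    using Y by (auto simp: pB_def pt_def cor_point_def)
  show "i \<in> {1..m} \<Longrightarrow> k \<in> {1..m} \<Longrightarrow>
      pAB (pt X Y) (l i) (r k) = of_bool (i \<in> X) * of_bool (k \<in> Y)"
    using X Y by (auto simp: pAB_def pt_def cor_point_def bipartite_ends_def)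
qed

text \<open>The edge terms are grouped by B-node, so that pairing with a vertex
  \<open>pt X Y\<close> leaves one bracket for each \<open>k \<in> Y\<close>.\<close>

lemma inner_bell:
  "x \<bullet> y = (\<Sum>i=1..m. pA x (l i) * pA y (l i)) +
     (\<Sum>k=1..m. pB x (r k) * pB y (r k) + (\<Sum>i=1..m. pAB x (l i) (r k) * pAB y (l i) (r k)))"
proof -
  have sumA: "(\<Sum>a\<in>UNIV. pA x a * pA y a) = (\<Sum>i=1..m. pA x (l i) * pA y (l i))"
    "(\<Sum>a\<in>UNIV. pAB x a b * pAB y a b) = (\<Sum>i=1..m. pAB x (l i) b * pAB y (l i) b)" for b
    by (simp_all add: sum.reindex_bij_betw[OF l, symmetric])
  have sumB: "sum g UNIV = (\<Sum>k=1..m. g (r k))" for g :: "'n \<Rightarrow> real"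
    by (simp only: sum.reindex_bij_betw[OF r])
  have "x \<bullet> y = (\<Sum>c\<in>UNIV. x $ c * y $ c)" by (simp add: inner_vec_def)
  also have "\<dots> = (\<Sum>a\<in>UNIV. pA x a * pA y a) + (\<Sum>b\<in>UNIV. pB x b * pB y b)
      + (\<Sum>(a, b)\<in>UNIV \<times> UNIV. pAB x a b * pAB y a b)"
    by (simp add: UNIV_Plus_UNIV[symmetric] sum.Plus pA_def pB_def pAB_def o_def
        case_prod_unfold del: UNIV_Plus_UNIV)
  also have "(\<Sum>(a, b)\<in>UNIV \<times> UNIV. pAB x a b * pAB y a b)
      = (\<Sum>b\<in>UNIV. \<Sum>a\<in>UNIV. pAB x a b * pAB y a b)"
    by (subst sum.cartesian_product[symmetric]) (rule sum.swap)
  finally show ?thesis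
    unfolding sumA sumB by (simp add: sum.distrib)
qed

lemma inner_pt:
  assumes "X \<subseteq> {1..m}" "Y \<subseteq> {1..m}"
  shows "x \<bullet> pt X Y =
    (\<Sum>i\<in>X. pA x (l i)) + (\<Sum>k\<in>Y. pB x (r k) + (\<Sum>i\<in>X. pAB x (l i) (r k)))"
proof -
  have restrict: "(\<Sum>i=1..m. g i * of_bool (i \<in> Z)) = (\<Sum>i\<in>Z. g i)"
    if "Z \<subseteq> {1..m}" for Z and g :: "nat \<Rightarrow> real"
    using that by (simp add: of_bool_def if_distrib sum.If_cases Int_absorb1 cong: if_cong)
  have "x \<bullet> pt X Y = (\<Sum>i=1..m. pA x (l i) * of_bool (i \<in> X)) +
     (\<Sum>k=1..m. (pB x (r k) + (\<Sum>i=1..m. pAB x (l i) (r k) * of_bool (i \<in> X))) * of_bool (k \<in> Y))"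
    unfolding inner_bell
    using assms
    by (intro arg_cong2[where f = "(+)"] sum.cong refl)
      (simp_all add: pA_pt pB_pt pAB_pt sum_distrib_right algebra_simps)
  then show ?thesis by (simp only: restrict assms)
qed

section \<open>The inequality at the vertices and its validity\<close>

text \<open>With \<open>j = m + 1 - k\<close>, the weight \<open>m - j\<close> becomes
  \<open>k - 1\<close>, \<open>i + j = m + 2\<close> becomes \<open>i = k + 1\<close>, and
  \<open>i + j \<le> m + 1\<close> becomes \<open>i \<le> k\<close>. The factor
  \<open>of_bool (k < m)\<close> cuts off \<open>l (m + 1)\<close>, which names no node in the
  numbering.\<close>

lemma Imm22_r:
  "Imm22 m l p = - pA p (l 1) + (\<Sum>k=1..m. (\<Sum>i=1..k. pAB p (l i) (r k))
     - real (k - 1) * pB p (r k) - of_bool (k < m) * pAB p (l (k + 1)) (r k))"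
proof -
  have 1: "(\<Sum>j = 1..m. (real m - real j) * pB p (l j)) = (\<Sum>k=1..m. real (k - 1) * pB p (r k))"
    by (rule sum.reindex_bij_witness[of _ "\<lambda>k. m + 1 - k" "\<lambda>k. m + 1 - k"])
      (auto simp: r_def of_nat_diff)
  have "(\<Sum>(i, j) \<in> {(i, j). 2 \<le> i \<and> i \<le> m \<and> 2 \<le> j \<and> j \<le> m \<and> i + j = m + 2}.
      pAB p (l i) (l j)) = (\<Sum>k\<in>{k\<in>{1..m}. k < m}. pAB p (l (k + 1)) (r k))"
    by (rule sum.reindex_bij_witness[of _ "\<lambda>k. (k + 1, m + 1 - k)" "\<lambda>(i, j). i - 1"])
      (auto simp: r_def, metis diff_add_inverse)
  also have "\<dots> = (\<Sum>k=1..m. of_bool (k < m) * pAB p (l (k + 1)) (r k))"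
    by (rule sum.mono_neutral_cong_left) auto
  finally have 2: "(\<Sum>(i, j) \<in> {(i, j). 2 \<le> i \<and> i \<le> m \<and> 2 \<le> j \<and> j \<le> m \<and> i + j = m + 2}.
      pAB p (l i) (l j)) = \<dots>" .
  have "(\<Sum>(i, j) \<in> {(i, j). 1 \<le> i \<and> i \<le> m \<and> 1 \<le> j \<and> j \<le> m \<and> i + j \<le> m + 1}.
      pAB p (l i) (l j)) = (\<Sum>(k, i)\<in>Sigma {1..m} (\<lambda>k. {1..k}). pAB p (l i) (r k))"
    by (rule sum.reindex_bij_witness[of _ "\<lambda>(k, i). (i, m + 1 - k)" "\<lambda>(i, j). (m + 1 - j, i)"])
      (auto simp: r_def)
  also have "\<dots> = (\<Sum>k=1..m. \<Sum>i=1..k. pAB p (l i) (r k))"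
    by (simp add: sum.Sigma)
  finally have 3: "(\<Sum>(i, j) \<in> {(i, j). 1 \<le> i \<and> i \<le> m \<and> 1 \<le> j \<and> j \<le> m \<and> i + j \<le> m + 1}.
      pAB p (l i) (l j)) = \<dots>" .
  show ?thesis
    unfolding Imm22_def 1 2 3 by (simp add: sum_subtractf)
qed

text \<open>The coefficient of b_k once the A-nodes in \<open>X\<close> are set to 1. Integer values
  turn \<open>card < k\<close> into \<open>c X k \<le> 0\<close>. For \<open>k = m\<close> and
  \<open>X \<subseteq> {1..m}\<close> the last term vanishes, in accordance with
  \<open>of_bool (k < m)\<close> in \<open>Imm22_r\<close>.\<close>

definition c :: "nat set \<Rightarrow> nat \<Rightarrow> int" where
  "c X k = int (card (X \<inter> {1..k})) - int (k - 1) - of_bool (k + 1 \<in> X)"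

lemma Imm22_pt:
  assumes "X \<subseteq> {1..m}" "Y \<subseteq> {1..m}"
  shows "Imm22 m l (pt X Y) = of_int ((\<Sum>k\<in>Y. c X k) - of_bool (1 \<in> X))"
proof -
  have "(\<Sum>i=1..k. pAB (pt X Y) (l i) (r k)) - real (k - 1) * pB (pt X Y) (r k)
      - of_bool (k < m) * pAB (pt X Y) (l (k + 1)) (r k) = (if k \<in> Y then of_int (c X k) else 0)"
    if k: "k \<in> {1..m}" for k
  proof -
    have "(\<Sum>i=1..k. pAB (pt X Y) (l i) (r k)) = (\<Sum>i=1..k. of_bool (i \<in> X) * of_bool (k \<in> Y))"
      using k by (intro sum.cong refl pAB_pt[OF assms]) auto
    also have "\<dots> = real (card (X \<inter> {1..k})) * of_bool (k \<in> Y)"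
      by (simp add: sum_distrib_right[symmetric] of_bool_def sum.If_cases Int_commute)
    finally have 1: "(\<Sum>i=1..k. pAB (pt X Y) (l i) (r k)) = \<dots>" .
    have 2: "of_bool (k < m) * pAB (pt X Y) (l (k + 1)) (r k)
        = of_bool (k + 1 \<in> X) * of_bool (k \<in> Y)"
    proof (cases "k < m")
      case True
      then show ?thesis using k by (subst pAB_pt[OF assms]) auto
    next
      case False
      then show ?thesis using assms k by auto
    qed
    show ?thesis unfolding 1 2 pB_pt[OF assms k] by (simp add: c_def)
  qed
  then have "Imm22 m l (pt X Y)
      = - pA (pt X Y) (l 1) + (\<Sum>k=1..m. if k \<in> Y then of_int (c X k) else 0)"
    unfolding Imm22_r by simp
  also have "\<dots> = - of_bool (1 \<in> X) + (\<Sum>k\<in>Y. of_int (c X k))"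
    using assms m pA_pt[OF assms, of 1] by (simp add: sum.If_cases Int_absorb1)
  finally show ?thesis by simp
qed

text \<open>\<open>c X k\<close> is positive only if \<open>k\<close> ends the initial run \<open>1, \<dots>, k\<close> of \<open>X\<close>; the bound is written
  as a difference so that the sum over \<open>k\<close> telescopes.\<close>

lemma c_le: "k \<ge> 1 \<Longrightarrow> c X k \<le> of_bool ({1..k} \<subseteq> X) - of_bool ({1..Suc k} \<subseteq> X)"
proof (cases "{1..k} \<subseteq> X")
  case True
  moreover assume "k \<ge> 1"
  ultimately show ?thesis
    by (auto simp: c_def Int_absorb1 atLeastAtMostSuc_conv)
next
  case False
  assume "k \<ge> 1"
  have "X \<inter> {1..k} \<subset> {1..k}" using False by (intro psubsetI) (auto dest: equalityD2)
  then have "card (X \<inter> {1..k}) < k" using psubset_card_mono[of "{1..k}" "X \<inter> {1..k}"] by simp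
  moreover have "\<not> {1..Suc k} \<subseteq> X" using False by (simp add: atLeastAtMostSuc_conv)
  ultimately show ?thesis using False \<open>k \<ge> 1\<close> by (simp add: c_def)
qed

lemma Imm22_pt_le_0:
  assumes "X \<subseteq> {1..m}" "Y \<subseteq> {1..m}"
  shows "Imm22 m l (pt X Y) \<le> 0"
proof -
  let ?d = "\<lambda>k. of_bool ({1..k} \<subseteq> X) :: int"
  have "(\<Sum>k\<in>Y. c X k) \<le> (\<Sum>k\<in>Y. ?d k - ?d (Suc k))"
    using assms by (intro sum_mono c_le) auto
  \<comment> \<open>\<open>?d\<close> is decreasing in \<open>k\<close>, so the added terms are
    nonnegative.\<close>
  also have "\<dots> \<le> (\<Sum>k=1..m. ?d k - ?d (Suc k))"
    using assms by (intro sum_mono2) auto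
  also have "\<dots> = ?d 1 - ?d (Suc m)"
    using m sum_Suc_diff[of 1 m "\<lambda>k. - ?d k"] by simp
  also have "\<dots> \<le> of_bool (1 \<in> X)" by auto
  finally show ?thesis unfolding Imm22_pt[OF assms] of_int_le_0_iff by linarith
qed

lemma Imm22_le_0:
  assumes "p \<in> cor_polytope bipartite_ends"
  shows "Imm22 m l p \<le> 0"
proof -
  have "convex {p. Imm22 m l p \<le> 0}"
    using convex_linear_vimage[OF linear_Imm22[of m l], of "{..0}"] by (simp add: vimage_def)
  moreover have "Imm22 m l (cor_point bipartite_ends S) \<le> 0" for S
    by (metis ex_pt Imm22_pt_le_0)
  ultimately have "cor_polytope bipartite_ends \<subseteq> {p. Imm22 m l p \<le> 0}"
    unfolding cor_polytope_def by (intro hull_minimal) auto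
  with assms show ?thesis by blast
qed

section \<open>The roots and \<open>pt {1} {}\<close> span the space\<close>

text \<open>By \<open>Imm22_pt\<close>, \<open>root\<close> covers the vertices with equality.
  Comparing roots that differ in few nodes isolates the entries of \<open>x\<close> one after
  another.\<close>

lemma eq_0_if_orthogonal:
  assumes A1: "x \<bullet> pt {1} {} = 0"
    and root: "\<And>X Y. X \<subseteq> {1..m} \<Longrightarrow> Y \<subseteq> {1..m} \<Longrightarrow>
      (\<Sum>k\<in>Y. c X k) = of_bool (1 \<in> X) \<Longrightarrow> x \<bullet> pt X Y = 0"
  shows "x = 0"
proof -
  let ?\<alpha> = "\<lambda>i. pA x (l i)" and ?\<beta> = "\<lambda>k. pB x (r k)" and ?\<gamma> = "\<lambda>i k. pAB x (l i) (r k)"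
  have \<alpha>: "?\<alpha> i = 0" if "i \<in> {1..m}" for i
  proof (cases "i = 1")
    case True
    then show ?thesis using A1 m by (simp add: inner_pt)
  next
    case False
    then show ?thesis using root[of "{i}" "{}"] that by (simp add: inner_pt)
  qed
  have root': "(\<Sum>k\<in>Y. ?\<beta> k + (\<Sum>i\<in>X. ?\<gamma> i k)) = 0"
    if "X \<subseteq> {1..m}" "Y \<subseteq> {1..m}" "(\<Sum>k\<in>Y. c X k) = of_bool (1 \<in> X)" for X Y
  proof -
    have "(\<Sum>i\<in>X. ?\<alpha> i) = 0" using that(1) \<alpha> by (intro sum.neutral) auto
    then show ?thesis using root[OF that] inner_pt[OF that(1,2), of x] by simp
  qed
  \<comment> \<open>Without A 1 the coefficients must sum to 0; here
    \<open>card {2..k} = k - 1\<close> gives \<open>c {2..k} k = 0\<close>.\<close>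
  have tail: "?\<beta> k + (\<Sum>i\<in>{2..k}. ?\<gamma> i k) = 0" if "k \<in> {1..m}" for k
  proof -
    have "{2..k} \<inter> {1..k} = {2..k}" by auto
    with that show ?thesis
      using root'[of "{2..k}" "{k}"] by (simp add: c_def subset_iff)
  qed
  \<comment> \<open>An index beyond \<open>k + 1\<close> does not affect \<open>c X k\<close>, so
    adding it to the previous root gives another root.\<close>
  have \<gamma>_high: "?\<gamma> i k = 0" if "k \<in> {1..m}" "i \<in> {1..m}" "i > k + 1" for i k
  proof -
    have "insert i {2..k} \<inter> {1..k} = {2..k}" using that by auto
    with that show ?thesis
      using root'[of "insert i {2..k}" "{k}"] tail[OF that(1)] by (simp add: c_def subset_iff)
  qed
  \<comment> \<open>Here A 1 is present, and \<open>c {1..k} k = k - (k - 1) = 1\<close> compensates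
    for it.\<close>
  have run: "?\<beta> k + (\<Sum>i\<in>{1..k}. ?\<gamma> i k) = 0" if "k \<in> {1..m}" for k
    using root'[of "{1..k}" "{k}"] that by (simp add: c_def subset_iff)
  have \<gamma>_1: "?\<gamma> 1 k = 0" if "k \<in> {1..m}" for k
  proof -
    have "{1..k} = insert 1 {2..k}" using that by auto
    then show ?thesis using run[OF that] tail[OF that] by simp
  qed
  \<comment> \<open>For \<open>X = {1..k + 1}\<close> the coefficient at \<open>k\<close> drops to
    0, so B \<open>k + 1\<close>, with coefficient 1, is added to restore equality. Its bracket
    vanishes by \<open>run\<close>.\<close>
  have \<gamma>_Suc: "?\<gamma> (k + 1) k = 0" if "k \<ge> 1" "k + 1 \<le> m" for k
  proof -
    have "{1..Suc k} \<inter> {1..k} = {1..k}" by auto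
    then have "(\<Sum>j\<in>{k, k + 1}. ?\<beta> j + (\<Sum>i\<in>{1..k + 1}. ?\<gamma> i j)) = 0"
      using that by (intro root') (auto simp: c_def)
    then show ?thesis
      using run[of k] run[of "k + 1"] that by (simp add: atLeastAtMostSuc_conv)
  qed
  have \<gamma>_low: "?\<gamma> (k + 1) j = 0" if "k \<ge> 1" "k < j" "j \<le> m" for j k
  proof -
    \<comment> \<open>The gap at \<open>k + 1\<close> ends the initial run at \<open>k\<close>, so
      \<open>c ?X k = 1\<close>; it also lowers the count up to \<open>j\<close> to
      \<open>j - 1\<close>, so \<open>c ?X j = 0\<close>.\<close>
    let ?X = "{1..j} - {k + 1}"
    have X: "?X \<inter> {1..k} = {1..k}" "?X \<inter> {1..j} = ?X" using that by auto
    have "(\<Sum>h\<in>{k, j}. ?\<beta> h + (\<Sum>i\<in>?X. ?\<gamma> i h)) = 0"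
    proof (intro root')
      show "(\<Sum>h\<in>{k, j}. c ?X h) = of_bool (1 \<in> ?X)"
        using that X by (simp add: c_def)
    qed (use that in auto)
    \<comment> \<open>All members of \<open>?X\<close> above \<open>k\<close> exceed
      \<open>k + 1\<close>, so \<open>\<gamma>_high\<close> removes them.\<close>
    moreover have "(\<Sum>i\<in>?X. ?\<gamma> i k) = (\<Sum>i\<in>{1..k}. ?\<gamma> i k)"
      using that by (intro sum.mono_neutral_right) (auto intro!: \<gamma>_high)
    moreover have "(\<Sum>i\<in>?X. ?\<gamma> i j) = (\<Sum>i\<in>{1..j}. ?\<gamma> i j) - ?\<gamma> (k + 1) j"
      using that by (subst sum_diff1) auto
    ultimately show ?thesis using run[of k] run[of j] that by simp
  qed
  have \<gamma>: "?\<gamma> i k = 0" if "i \<in> {1..m}" "k \<in> {1..m}" for i k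
  proof (cases "i = 1")
    case True
    then show ?thesis using \<gamma>_1 that by simp
  next
    case False
    with that obtain h where h: "i = h + 1" "1 \<le> h" by (cases i) auto
    show ?thesis
    proof (cases h k rule: linorder_cases)
      case less
      then show ?thesis using \<gamma>_low[of h k] h that by simp
    next
      case equal
      then show ?thesis using \<gamma>_Suc[of k] h that by simp
    next
      case greater
      then show ?thesis using \<gamma>_high[of k i] h that by simp
    qed
  qed
  have \<beta>: "?\<beta> k = 0" if "k \<in> {1..m}" for k
    using tail[OF that] that \<gamma> by simp
  have "x \<bullet> x = 0"
    unfolding inner_bell using \<alpha> \<beta> \<gamma> by simp
  then show ?thesis by simp
qed

end

theorem theorem6:
  fixes m :: nat and l :: "nat \<Rightarrow> 'n::finite"
  assumes "m \<ge> 1" and "bij_betw l {1..m} (UNIV :: 'n set)"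
  shows "defines_facet (Imm22 m l) 0 (cor_polytope (bipartite_ends :: 'n \<times> 'n \<Rightarrow> ('n + 'n) set))"
proof -
  interpret numbering m l using assms by unfold_locales
  let ?P = "cor_polytope (bipartite_ends :: 'n \<times> 'n \<Rightarrow> ('n + 'n) set)"
  show ?thesis
  \<comment> \<open>At \<open>pt {1} {}\<close> only A 1 is set, and the left-hand side is
    -1.\<close>
  proof (rule defines_facetI_span[where y = "pt {1} {}"])
    \<comment> \<open>Its inner product with itself consists of empty sums.\<close>
    have "pt {} {} = 0"
      using inner_pt[of "{}" "{}" "pt {} {}"] by simp
    then show "0 \<in> ?P" using pt_in_cor_polytope[of "{}" "{}"] by simp
    show "Imm22 m l (pt {1} {}) \<noteq> 0" using assms(1) by (simp add: Imm22_pt)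
    show "span (insert (pt {1} {}) {p \<in> ?P. Imm22 m l p = 0}) = UNIV"
      by (intro span_eq_UNIV_if_orthogonal_0 eq_0_if_orthogonal)
        (auto simp: pt_in_cor_polytope Imm22_pt)
  qed (auto simp: linear_Imm22 Imm22_le_0 pt_in_cor_polytope)
qed

end
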